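(* Let $c_L,h\in\mathbb{C}$, $c_{L,I}\in\mathbb{C}\setminus\{0\}$, and let $h_I\in\mathbb{C}$ be such that $\frac{h_I}{c_{L,I}}-1=-p$ with $p\in\mathbb{Z}_{>0}$. Let $v$ be the highest weight vector of $V^{\mathcal H}(c_L,0,c_{L,I},h,h_I)$ and let $\Lambda\in V^{\mathcal H}(c_L,0,c_{L,I},h,h_I)_p$ be a singular vector. Then, up to a nonzero scalar factor, $$\Lambda=\sum_{i=0}^{p-1}S_i\left(\frac{I(-1)}{c_{L,I}},\dots,\frac{I(-i)}{c_{L,I}}\right)L(i-p)v+x_pv$$ for some $x_pv\in\mathcal I_p$.
   Context: The twisted Heisenberg-Virasoro algebra $\mathcal H$ is the complex Lie algebra with basis $\{L(n),I(n):n\in\mathbb{Z}\}\cup\{C_L,C_{LI},C_I\}$ and brackets $[L(n),L(m)]=(n-m)L(n+m)+\delta_{n,-m}\frac{n^3-n}{12}C_L$, $[L(n),I(m)]=-mI(n+m)-\delta_{n,-m}(n^2+n)C_{LI}$, $[I(n),I(m)]=n\delta_{n,-m}C_I$, with $C_L,C_{LI},C_I$ central. $V^{\mathcal H}(c_L,0,c_{L,I},h,h_I)$ is the Verma module with highest weight vector $v$: $L(n)v=I(n)v=0$ for $n>0$, $L(0)v=hv$, $I(0)v=h_Iv$, and $C_L,C_I,C_{LI}$ act as $c_L,0,c_{L,I}$; it is free of rank one over $U(\mathcal H_-)$, $\mathcal H_-=\mathrm{span}\{L(-n),I(-n):n\ge1\}$. Subscript $p$ denotes the component of conformal weight $p$,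 i.e. the $L(0)$-eigenspace of eigenvalue $h+p$; $\mathcal I=\mathbb{C}[I(-1),I(-2),\dots]v$ and $\mathcal I_p$ is its weight-$p$ component. A singular vector is a nonzero vector annihilated by all $L(n),I(n)$, $n>0$, that is an eigenvector of $L(0)$ and $I(0)$. The Schur polynomials are defined by $\exp\left(\sum_{n\ge1}\frac{x_n}{n}y^n\right)=\sum_{r\ge0}S_r(x_1,x_2,\dots)y^r$; $S_0=1$ and $S_r$ involves only $x_1,\dots,x_r$. *)

theory Defs
  imports
    Complex_Main
    "HOL-Library.Poly_Mapping"
    "HOL-Computational_Algebra.Formal_Power_Series"
begin

section \<open>The twisted Heisenberg-Virasoro algebra\<close>

datatype hv_basis = HL int | HI int | HCL | HCLI | HCI

type_synonym hv = "hv_basis \<Rightarrow>\<^sub>0 complex"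

definition hv_scale :: "complex \<Rightarrow> hv \<Rightarrow> hv" where
  "hv_scale c X = Poly_Mapping.map ((*) c) X"

definition hv_elt :: "hv_basis \<Rightarrow> hv" where
  "hv_elt b = Poly_Mapping.single b 1"

fun hv_bracket_basis :: "hv_basis \<Rightarrow> hv_basis \<Rightarrow> hv" where
  "hv_bracket_basis (HL n) (HL m) =
     hv_scale (of_int (n - m)) (hv_elt (HL (n + m)))
     + (if n = - m then hv_scale ((of_int n ^ 3 - of_int n) / 12) (hv_elt HCL) else 0)"
| "hv_bracket_basis (HL n) (HI m) =
     hv_scale (- of_int m) (hv_elt (HI (n + m)))
     - (if n = - m then hv_scale ((of_int n)\<^sup>2 + of_int n) (hv_elt HCLI) else 0)"
| "hv_bracket_basis (HI n) (HL m) =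
     - (hv_scale (- of_int n) (hv_elt (HI (m + n)))
        - (if m = - n then hv_scale ((of_int m)\<^sup>2 + of_int m) (hv_elt HCLI) else 0))"
| "hv_bracket_basis (HI n) (HI m) =
     (if n = - m then hv_scale (of_int n) (hv_elt HCI) else 0)"
| "hv_bracket_basis _ _ = 0"

definition hv_bracket :: "hv \<Rightarrow> hv \<Rightarrow> hv" where
  "hv_bracket X Y =
     (\<Sum>a\<in>Poly_Mapping.keys X. \<Sum>b\<in>Poly_Mapping.keys Y.
        hv_scale (Poly_Mapping.lookup X a * Poly_Mapping.lookup Y b) (hv_bracket_basis a b))"

definition hv_minus_basis :: "hv_basis set" where
  "hv_minus_basis = {HL (- n) |n. n \<ge> 1} \<union> {HI (- n) |n. n \<ge> 1}"

text \<open>The span of a set of basis vectors; for \<^term>\<open>hv_minus_basis\<close> this is the subalgebra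
  spanned by all $L(-n)$, $I(-n)$ with $n \ge 1$.\<close>

definition hv_span :: "hv_basis set \<Rightarrow> hv set" where
  "hv_span B = {X. Poly_Mapping.keys X \<subseteq> B}"

section \<open>Universal enveloping algebras\<close>

text \<open>Words form a monoid under concatenation, so that \<^typ>\<open>'b list \<Rightarrow>\<^sub>0 complex\<close>, with the
  convolution product of Poly\_Mapping, is the free associative algebra on \<^typ>\<open>'b\<close>, i.e. the
  tensor algebra of the vector space with basis \<^typ>\<open>'b\<close>.\<close>

instantiation list :: (type) monoid_add
begin

definition zero_list :: "'a list" where "zero_list = []"
definition plus_list :: "'a list \<Rightarrow> 'a list \<Rightarrow> 'a list" where "plus_list xs ys = xs @ ys"

instance
  by standard (simp_all add: zero_list_def plus_list_def)

end

type_synonym hv_tensor = "hv_basis list \<Rightarrow>\<^sub>0 complex"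

definition tensor_algebra :: "hv_basis set \<Rightarrow> hv_tensor set" where
  "tensor_algebra B = {t. \<forall>w\<in>Poly_Mapping.keys t. set w \<subseteq> B}"

definition tensor_of :: "hv \<Rightarrow> hv_tensor" where
  "tensor_of X = (\<Sum>b\<in>Poly_Mapping.keys X. Poly_Mapping.single [b] (Poly_Mapping.lookup X b))"

text \<open>For \<open>B\<close> spanning a Lie subalgebra, the universal enveloping algebra of \<^term>\<open>hv_span B\<close> is
  the quotient of \<^term>\<open>tensor_algebra B\<close> by the following two-sided ideal.\<close>

inductive_set enveloping_ideal :: "hv_basis set \<Rightarrow> hv_tensor set" for B :: "hv_basis set" where
  zero: "0 \<in> enveloping_ideal B"
| gen: "\<lbrakk>X \<in> hv_span B; Y \<in> hv_span B; s \<in> tensor_algebra B; t \<in> tensor_algebra B\<rbrakk> \<Longrightarrow>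
    s * (tensor_of X * tensor_of Y - tensor_of Y * tensor_of X - tensor_of (hv_bracket X Y)) * t
      \<in> enveloping_ideal B"
| add: "\<lbrakk>s \<in> enveloping_ideal B; t \<in> enveloping_ideal B\<rbrakk> \<Longrightarrow> s + t \<in> enveloping_ideal B"

section \<open>Modules and Verma modules\<close>

definition hv_module ::
  "(complex \<Rightarrow> 'v \<Rightarrow> 'v::ab_group_add) \<Rightarrow> (hv \<Rightarrow> 'v \<Rightarrow> 'v) \<Rightarrow> bool" where
  "hv_module scale act \<longleftrightarrow>
     vector_space scale \<and>
     (\<forall>X. Vector_Spaces.linear scale scale (act X)) \<and>
     (\<forall>w. Vector_Spaces.linear hv_scale scale (\<lambda>X. act X w)) \<and>
     (\<forall>X Y w. act (hv_bracket X Y) w = act X (act Y w) - act Y (act X w))"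

definition tensor_act ::
  "(complex \<Rightarrow> 'v \<Rightarrow> 'v::ab_group_add) \<Rightarrow> (hv \<Rightarrow> 'v \<Rightarrow> 'v) \<Rightarrow> hv_tensor \<Rightarrow> 'v \<Rightarrow> 'v" where
  "tensor_act scale act t w =
     (\<Sum>u\<in>Poly_Mapping.keys t. scale (Poly_Mapping.lookup t u) (foldr (\<lambda>b. act (hv_elt b)) u w))"

text \<open>Free of rank one with generator \<open>v\<close> over the enveloping algebra of \<^term>\<open>hv_span B\<close>: the
  map \<open>u \<mapsto> u v\<close> from that algebra to the module is a bijection, i.e. the corresponding map from
  the tensor algebra is onto and its kernel is the defining ideal.\<close>

definition free_rank_one ::
  "(complex \<Rightarrow> 'v \<Rightarrow> 'v::ab_group_add) \<Rightarrow> (hv \<Rightarrow> 'v \<Rightarrow> 'v) \<Rightarrow> hv_basis set \<Rightarrow> 'v \<Rightarrow> bool" where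
  "free_rank_one scale act B v \<longleftrightarrow>
     (\<forall>w. \<exists>t\<in>tensor_algebra B. tensor_act scale act t v = w) \<and>
     (\<forall>t\<in>tensor_algebra B. tensor_act scale act t v = 0 \<longleftrightarrow> t \<in> enveloping_ideal B)"

text \<open>The parameters are in the order of $V^{\mathcal H}(c_L, c_I, c_{L,I}, h, h_I)$, followed by
  the highest weight vector.\<close>

definition verma_module ::
  "(complex \<Rightarrow> 'v \<Rightarrow> 'v::ab_group_add) \<Rightarrow> (hv \<Rightarrow> 'v \<Rightarrow> 'v) \<Rightarrow>
   complex \<Rightarrow> complex \<Rightarrow> complex \<Rightarrow> complex \<Rightarrow> complex \<Rightarrow> 'v \<Rightarrow> bool" where
  "verma_module scale act c\<^sub>L c\<^sub>I c\<^sub>L\<^sub>I h h\<^sub>I v \<longleftrightarrow>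
     hv_module scale act \<and>
     (\<forall>w. act (hv_elt HCL) w = scale c\<^sub>L w) \<and>
     (\<forall>w. act (hv_elt HCI) w = scale c\<^sub>I w) \<and>
     (\<forall>w. act (hv_elt HCLI) w = scale c\<^sub>L\<^sub>I w) \<and>
     (\<forall>n>0. act (hv_elt (HL n)) v = 0 \<and> act (hv_elt (HI n)) v = 0) \<and>
     act (hv_elt (HL 0)) v = scale h v \<and>
     act (hv_elt (HI 0)) v = scale h\<^sub>I v \<and>
     free_rank_one scale act hv_minus_basis v"

definition weight_component ::
  "(complex \<Rightarrow> 'v \<Rightarrow> 'v::ab_group_add) \<Rightarrow> (hv \<Rightarrow> 'v \<Rightarrow> 'v) \<Rightarrow> complex \<Rightarrow> nat \<Rightarrow> 'v set" where
  "weight_component scale act h q = {w. act (hv_elt (HL 0)) w = scale (h + of_nat q) w}"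

definition singular_vector ::
  "(complex \<Rightarrow> 'v \<Rightarrow> 'v::ab_group_add) \<Rightarrow> (hv \<Rightarrow> 'v \<Rightarrow> 'v) \<Rightarrow> 'v \<Rightarrow> bool" where
  "singular_vector scale act w \<longleftrightarrow>
     w \<noteq> 0 \<and>
     (\<forall>n>0. act (hv_elt (HL n)) w = 0 \<and> act (hv_elt (HI n)) w = 0) \<and>
     (\<exists>\<mu>. act (hv_elt (HL 0)) w = scale \<mu> w) \<and>
     (\<exists>\<nu>. act (hv_elt (HI 0)) w = scale \<nu> w)"

section \<open>Polynomials and Schur polynomials\<close>

text \<open>Polynomials in variables $x_n$ indexed by naturals; the index 0 is never used.\<close>

type_synonym cpoly = "(nat \<Rightarrow>\<^sub>0 nat) \<Rightarrow>\<^sub>0 complex"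

definition cpoly_const :: "complex \<Rightarrow> cpoly" where
  "cpoly_const c = Poly_Mapping.single 0 c"

definition cpoly_var :: "nat \<Rightarrow> cpoly" where
  "cpoly_var n = Poly_Mapping.single (Poly_Mapping.single n 1) 1"

definition schur :: "nat \<Rightarrow> cpoly" where
  "schur r = fps_nth
     (Abs_fps (\<lambda>k. cpoly_const (1 / fact k)) oo
      Abs_fps (\<lambda>n. if n = 0 then 0 else cpoly_const (1 / of_nat n) * cpoly_var n)) r"

text \<open>The value \<open>P(T 1, T 2, ...) w\<close> for operators \<open>T n\<close>. The factors of a monomial are applied in
  a fixed order of the variables, which is immaterial for commuting operators.\<close>

definition cpoly_act ::
  "(complex \<Rightarrow> 'v \<Rightarrow> 'v::ab_group_add) \<Rightarrow> (nat \<Rightarrow> 'v \<Rightarrow> 'v) \<Rightarrow> cpoly \<Rightarrow> 'v \<Rightarrow> 'v" where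
  "cpoly_act scale T P w =
     (\<Sum>m\<in>Poly_Mapping.keys P. scale (Poly_Mapping.lookup P m)
        (foldr (\<lambda>n. T n ^^ Poly_Mapping.lookup m n) (sorted_list_of_set (Poly_Mapping.keys m)) w))"

definition I_component ::
  "(complex \<Rightarrow> 'v \<Rightarrow> 'v::ab_group_add) \<Rightarrow> (hv \<Rightarrow> 'v \<Rightarrow> 'v) \<Rightarrow> 'v \<Rightarrow> complex \<Rightarrow> nat \<Rightarrow> 'v set" where
  "I_component scale act v h q =
     {cpoly_act scale (\<lambda>n. act (hv_elt (HI (- int n)))) P v |P.
        \<forall>m\<in>Poly_Mapping.keys P. 0 \<notin> Poly_Mapping.keys m}
     \<inter> weight_component scale act h q"

end

theory Submission
  imports Defs
begin

text \<open>Spanning by words in the negative modes is all that is needed of freeness; no PBW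
  basis enters. Since the $I(n)$ commute among themselves, the operator
  $E = \sum_{0<n<p} \frac{n+1}{n c_{L,I} (n-p)} L(-n) I(n)$ acts on words, modulo words of lower
  degree, as multiplication by the degree, where a letter $L(-m)$ has degree $m+1$ and $I(-m)$ has
  degree 0; the only exception among words of weight at most $p$ is $L(-p)v$. A vector of weight $p$
  killed by all $I(n)$, $n>0$, can therefore be pushed down in degree until it is a multiple of
  $s = \sum_i S_i L(i-p)v$ plus an element of $\mathcal I_p$; that $s$ itself is killed by the
  $I(n)$ is the recursion $r S_r = \sum_j x_j S_{r-j}$. The multiple is nonzero because
  $-\sum_{0<n\le p} \frac{1}{c_{L,I}(n+p)} I(-n) L(n)$ acts on $\mathcal I_p$, modulo words of
  greater length, as multiplication by $p$, so that no singular vector lies in $\mathcal I_p$.\<close>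

lemma cpoly_const_mult: "cpoly_const a * cpoly_const b = cpoly_const (a * b)"
  by (simp add: cpoly_const_def mult_single)

lemma cpoly_const_of_nat: "of_nat k = cpoly_const (of_nat k)"
  by (simp add: cpoly_const_def)

lemma poly_mapping_sum_monomials:
  "(\<Sum>m\<in>Poly_Mapping.keys P. Poly_Mapping.single m (Poly_Mapping.lookup P m)) = P"
  by (rule poly_mapping_eqI)
    (auto simp: lookup_sum lookup_single when_def in_keys_iff)

lemma schur_0: "schur 0 = 1"
  by (simp add: schur_def cpoly_const_def)

lemma schur_newton:
  "cpoly_const (of_nat (Suc r)) * schur (Suc r) = (\<Sum>i\<le>r. cpoly_var (Suc i) * schur (r - i))"
proof -
  define e where "e = Abs_fps (\<lambda>k. cpoly_const (1 / fact k))"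
  define g where "g = Abs_fps (\<lambda>n. if n = 0 then 0 else cpoly_const (1 / of_nat n) * cpoly_var n)"
  have e: "fps_deriv e = e"
  proof (rule fps_ext)
    fix n :: nat
    have "of_nat (n + 1) * cpoly_const (1 / fact (n + 1)) = cpoly_const (1 / fact n)"
      unfolding cpoly_const_of_nat cpoly_const_mult
      by (simp add: divide_simps del: of_nat_Suc of_nat_add)
    thus "fps_nth (fps_deriv e) n = fps_nth e n" by (simp add: e_def)
  qed
  have g: "fps_nth (fps_deriv g) n = cpoly_var (Suc n)" for n
  proof -
    have "of_nat (n + 1) * (cpoly_const (1 / of_nat (n + 1)) * cpoly_var (n + 1))
        = cpoly_const (of_nat (n + 1) * (1 / of_nat (n + 1))) * cpoly_var (n + 1)"
      unfolding cpoly_const_of_nat mult.assoc[symmetric] cpoly_const_mult ..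
    also have "\<dots> = cpoly_var (Suc n)"
      by (simp del: of_nat_Suc add: cpoly_const_def)
    finally show ?thesis by (simp add: g_def)
  qed
  have "fps_deriv (e oo g) = (e oo g) * fps_deriv g"
    using fps_compose_deriv[of g e] by (simp add: e g_def)
  hence "fps_nth (fps_deriv (e oo g)) r = fps_nth (fps_deriv g * (e oo g)) r" by (simp add: mult.commute)
  hence "of_nat (Suc r) * schur (Suc r) = (\<Sum>i=0..r. cpoly_var (Suc i) * schur (r - i))"
    unfolding fps_mult_nth g by (simp add: schur_def e_def g_def)
  thus ?thesis unfolding cpoly_const_of_nat atMost_atLeast0 .
qed

locale commuting_operators = vector_space scale
  for scale :: "complex \<Rightarrow> 'v \<Rightarrow> 'v::ab_group_add" +
  fixes T :: "nat \<Rightarrow> 'v \<Rightarrow> 'v"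
  assumes T_add: "T n (x + y) = T n x + T n y"
    and T_scale: "T n (scale c x) = scale c (T n x)"
    and T_commute: "T m (T n x) = T n (T m x)"
begin

definition monom_act :: "(nat \<Rightarrow>\<^sub>0 nat) \<Rightarrow> 'v \<Rightarrow> 'v" where
  "monom_act m = foldr (\<lambda>n. T n ^^ Poly_Mapping.lookup m n)
     (sorted_list_of_set (Poly_Mapping.keys m))"

lemma T_0: "T n 0 = 0"
  using T_scale[of n 0 0] by simp

lemma T_sum: "T n (sum f A) = (\<Sum>x\<in>A. T n (f x))"
  by (induction A rule: infinite_finite_induct) (simp_all add: T_0 T_add)

lemma cpoly_act_superset:
  assumes "finite A" "Poly_Mapping.keys P \<subseteq> A"
  shows "cpoly_act scale T P w = (\<Sum>m\<in>A. scale (Poly_Mapping.lookup P m) (monom_act m w))"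
  unfolding cpoly_act_def monom_act_def
  by (rule sum.mono_neutral_left) (use assms in \<open>auto simp: in_keys_iff\<close>)

lemma cpoly_act_0: "cpoly_act scale T 0 w = 0"
  by (simp add: cpoly_act_def)

lemma cpoly_act_add: "cpoly_act scale T (P + Q) w = cpoly_act scale T P w + cpoly_act scale T Q w"
proof -
  let ?A = "Poly_Mapping.keys P \<union> Poly_Mapping.keys Q"
  have "Poly_Mapping.keys (P + Q) \<subseteq> ?A" by (rule keys_add)
  thus ?thesis
    by (simp add: cpoly_act_superset[of ?A] lookup_add scale_left_distrib sum.distrib)
qed

lemma cpoly_act_sum: "cpoly_act scale T (sum f A) w = (\<Sum>x\<in>A. cpoly_act scale T (f x) w)"
  by (induction A rule: infinite_finite_induct) (simp_all add: cpoly_act_0 cpoly_act_add)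

lemma cpoly_act_single: "cpoly_act scale T (Poly_Mapping.single m c) w = scale c (monom_act m w)"
  using cpoly_act_superset[of "{m}" "Poly_Mapping.single m c" w] by simp

lemma cpoly_act_1: "cpoly_act scale T 1 w = w"
  unfolding single_one[symmetric] cpoly_act_single by (simp add: monom_act_def)

lemma power_comp_fun_commute: "comp_fun_commute (\<lambda>n. T n ^^ f n)"
proof
  have 1: "(T k ^^ b) (T n x) = T n ((T k ^^ b) x)" for k n b x
    by (induction b) (simp_all add: T_commute[of k n])
  have "(T k ^^ b) ((T n ^^ a) x) = (T n ^^ a) ((T k ^^ b) x)" for k n a b x
    by (induction a) (simp_all add: 1)
  thus "(T y ^^ f y) \<circ> (T x ^^ f x) = (T x ^^ f x) \<circ> (T y ^^ f y)" for x y
    by (simp add: fun_eq_iff)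
qed

lemma monom_act_fold:
  "monom_act m w = Finite_Set.fold (\<lambda>n. T n ^^ Poly_Mapping.lookup m n) w (Poly_Mapping.keys m)"
proof -
  interpret comp_fun_commute "\<lambda>n. T n ^^ Poly_Mapping.lookup m n"
    by (rule power_comp_fun_commute)
  let ?xs = "sorted_list_of_set (Poly_Mapping.keys m)"
  have "monom_act m w = fold (\<lambda>n. T n ^^ Poly_Mapping.lookup m n) ?xs w"
    unfolding monom_act_def by (subst foldr_fold) (auto intro: comp_fun_commute)
  also have "\<dots> = Finite_Set.fold (\<lambda>n. T n ^^ Poly_Mapping.lookup m n) w (set ?xs)"
    using fold_set_fold_remdups[where xs = ?xs and y = w]
    by (simp add: distinct_remdups_id)
  finally show ?thesis by simp
qed

lemma monom_act_single_add: "monom_act (Poly_Mapping.single n 1 + m) w = T n (monom_act m w)"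
proof -
  let ?m = "Poly_Mapping.single n 1 + m"
  let ?A = "Poly_Mapping.keys m - {n}"
  interpret a: comp_fun_commute "\<lambda>n. T n ^^ Poly_Mapping.lookup m n"
    by (rule power_comp_fun_commute)
  interpret b: comp_fun_commute "\<lambda>n. T n ^^ Poly_Mapping.lookup ?m n"
    by (rule power_comp_fun_commute)
  have keys: "Poly_Mapping.keys ?m = insert n ?A"
    by (auto simp: in_keys_iff lookup_add lookup_single when_def split: if_splits)
  have "Finite_Set.fold (\<lambda>n. T n ^^ Poly_Mapping.lookup ?m n) w ?A
      = Finite_Set.fold (\<lambda>n. T n ^^ Poly_Mapping.lookup m n) w ?A"
    by (rule fold_closed_eq[where B = UNIV]) (auto simp: lookup_add lookup_single)
  moreover have "monom_act m w = (T n ^^ Poly_Mapping.lookup m n)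
      (Finite_Set.fold (\<lambda>n. T n ^^ Poly_Mapping.lookup m n) w ?A)"
  proof (cases "n \<in> Poly_Mapping.keys m")
    case True
    thus ?thesis unfolding monom_act_fold by (subst a.fold_rec) auto
  next
    case False
    thus ?thesis unfolding monom_act_fold by (simp add: in_keys_iff)
  qed
  moreover have "monom_act ?m w = (T n ^^ Poly_Mapping.lookup ?m n)
      (Finite_Set.fold (\<lambda>n. T n ^^ Poly_Mapping.lookup ?m n) w ?A)"
    unfolding monom_act_fold keys by (subst b.fold_insert) auto
  ultimately show ?thesis by (simp add: lookup_add)
qed

lemma cpoly_act_const_mult:
  "cpoly_act scale T (cpoly_const c * P) w = scale c (cpoly_act scale T P w)"
proof -
  have "cpoly_act scale T (cpoly_const c * (\<Sum>m\<in>A. Poly_Mapping.single m (f m))) w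
      = scale c (cpoly_act scale T (\<Sum>m\<in>A. Poly_Mapping.single m (f m)) w)" for A f
    by (simp add: sum_distrib_left cpoly_act_sum cpoly_const_def mult_single cpoly_act_single
        scale_sum_right)
  from this[of "Poly_Mapping.lookup P" "Poly_Mapping.keys P"] show ?thesis
    by (simp add: poly_mapping_sum_monomials)
qed

lemma cpoly_act_var_mult:
  "cpoly_act scale T (cpoly_var n * P) w = T n (cpoly_act scale T P w)"
proof -
  have "cpoly_act scale T (cpoly_var n * (\<Sum>m\<in>A. Poly_Mapping.single m (f m))) w
      = T n (cpoly_act scale T (\<Sum>m\<in>A. Poly_Mapping.single m (f m)) w)" for A f
    by (simp add: sum_distrib_left cpoly_act_sum cpoly_var_def mult_single cpoly_act_single
        T_sum T_scale monom_act_single_add[simplified])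
  from this[of "Poly_Mapping.lookup P" "Poly_Mapping.keys P"] show ?thesis
    by (simp add: poly_mapping_sum_monomials)
qed

lemma cpoly_act_commute:
  assumes A: "Vector_Spaces.linear scale scale A" and comm: "\<And>n x. A (T n x) = T n (A x)"
  shows "A (cpoly_act scale T P w) = cpoly_act scale T P (A w)"
proof -
  interpret A: Vector_Spaces.linear scale scale A by (rule A)
  have pow: "A ((T n ^^ k) x) = (T n ^^ k) (A x)" for n k x
    by (induction k) (simp_all add: comm)
  have "A (foldr (\<lambda>n. T n ^^ f n) ns x) = foldr (\<lambda>n. T n ^^ f n) ns (A x)" for f ns x
    by (induction ns) (simp_all add: pow)
  thus ?thesis by (simp add: cpoly_act_def A.sum A.scale)
qed

lemma schur_act_newton:
  "scale (of_nat (Suc r)) (cpoly_act scale T (schur (Suc r)) w)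
     = (\<Sum>i\<le>r. T (Suc i) (cpoly_act scale T (schur (r - i)) w))"
  using arg_cong[OF schur_newton, of "\<lambda>P. cpoly_act scale T P w" r]
  by (simp add: cpoly_act_const_mult cpoly_act_sum cpoly_act_var_mult del: of_nat_Suc)

end

text \<open>\<open>l n\<close> and \<open>i n\<close> stand for the actions of $L(n)$ and $I(n)$. Only those commutators of the
  $L(n)$ that do not involve $C_L$ are needed.\<close>

locale hv_highest_weight = vector_space scale
  for scale :: "complex \<Rightarrow> 'v \<Rightarrow> 'v::ab_group_add" +
  fixes l i :: "int \<Rightarrow> 'v \<Rightarrow> 'v" and c h hI :: complex and v :: 'v and p :: nat
  assumes l_linear: "Vector_Spaces.linear scale scale (l n)"
    and i_linear: "Vector_Spaces.linear scale scale (i n)"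
    and l_l: "n + m \<noteq> 0 \<Longrightarrow> l n (l m w) = l m (l n w) + scale (of_int (n - m)) (l (n + m) w)"
    and l_i: "l n (i m w) = i m (l n w) - scale (of_int m) (i (n + m) w)
      - (if n = - m then scale (((of_int n)\<^sup>2 + of_int n) * c) w else 0)"
    and i_i: "i n (i m w) = i m (i n w)"
    and l_pos: "n > 0 \<Longrightarrow> l n v = 0"
    and i_pos: "n > 0 \<Longrightarrow> i n v = 0"
    and l_0: "l 0 v = scale h v"
    and i_0_v: "i 0 v = scale hI v"
    and generated: "\<lbrakk>P v; \<And>x y. P x \<Longrightarrow> P y \<Longrightarrow> P (x + y); \<And>a x. P x \<Longrightarrow> P (scale a x);
      \<And>m x. m > 0 \<Longrightarrow> P x \<Longrightarrow> P (l (- m) x); \<And>m x. m > 0 \<Longrightarrow> P x \<Longrightarrow> P (i (- m) x)\<rbrakk> \<Longrightarrow> P w"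
    and c_nonzero: "c \<noteq> 0"
    and p_pos: "p > 0"
    and hI: "hI = c * (1 - of_nat p)"
begin

sublocale l: Vector_Spaces.linear scale scale "l n" for n
  by (rule l_linear)

sublocale i: Vector_Spaces.linear scale scale "i n" for n
  by (rule i_linear)

sublocale schur: commuting_operators scale "\<lambda>n w. scale (1 / c) (i (- int n) w)"
  by unfold_locales
    (simp_all add: i.add i.scale scale_right_distrib i_i scale_left_commute)

sublocale Ipoly: commuting_operators scale "\<lambda>n. i (- int n)"
  by unfold_locales (simp_all add: i.add i.scale i_i)

lemma i_l: "i n (l m w) = l m (i n w) + scale (of_int n) (i (n + m) w)
    + (if n = - m then scale (((of_int n)\<^sup>2 - of_int n) * c) w else 0)"
  using l_i[of m n w] by (auto simp: algebra_simps)

lemma i_0: "i 0 w = scale hI w"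
  by (rule generated)
    (simp_all add: i_0_v i.add i.scale scale_right_distrib scale_left_commute i_l l.scale
      i_i[of 0])

lemma i_l_same: "i n (l (- n) w) = l (- n) (i n w) + scale (of_int n * c * (of_int n - of_nat p)) w"
proof -
  have "scale (of_int n) (scale hI w) + scale (((of_int n)\<^sup>2 - of_int n) * c) w
      = scale (of_int n * hI + ((of_int n)\<^sup>2 - of_int n) * c) w"
    by (simp add: scale_left_distrib)
  also have "of_int n * hI + ((of_int n)\<^sup>2 - of_int n) * c = of_int n * c * (of_int n - of_nat p)"
    by (simp add: hI algebra_simps power2_eq_square)
  finally show ?thesis by (simp add: i_l[of n] i_0 add.assoc)
qed

lemma l_i_same:
  "l n (i (- n) w) = i (- n) (l n w) - scale (of_int n * c * (of_int n + of_nat p)) w"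
proof -
  have "scale (of_int n) (scale hI w) - scale (((of_int n)\<^sup>2 + of_int n) * c) w
      = scale (of_int n * hI - ((of_int n)\<^sup>2 + of_int n) * c) w"
    by (simp add: scale_left_diff_distrib)
  also have "of_int n * hI - ((of_int n)\<^sup>2 + of_int n) * c = - (of_int n * c * (of_int n + of_nat p))"
    by (simp add: hI algebra_simps power2_eq_square)
  finally show ?thesis by (simp add: l_i[of n] i_0 algebra_simps)
qed

text \<open>The span of the words of weight \<open>q\<close> in the \<open>i (- m)\<close> and \<open>l (- m)\<close>, $m \ge 1$, for which
  the sum of \<open>m + 1\<close> over all letters \<open>l (- m)\<close> is less than \<open>k\<close>. With this choice of degree,
  \<open>i n\<close> lowers the degree by at least \<open>n + 1\<close>.\<close>

inductive F :: "int \<Rightarrow> int \<Rightarrow> 'v \<Rightarrow> bool" where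
  F_zero: "F q k 0"
| F_vac: "k > 0 \<Longrightarrow> F 0 k v"
| F_add: "F q k x \<Longrightarrow> F q k y \<Longrightarrow> F q k (x + y)"
| F_scale: "F q k x \<Longrightarrow> F q k (scale a x)"
| F_I: "m > 0 \<Longrightarrow> F q k x \<Longrightarrow> F (q + m) k (i (- m) x)"
| F_L: "m > 0 \<Longrightarrow> F q k x \<Longrightarrow> F (q + m) (k + m + 1) (l (- m) x)"

lemma F_diff: "F q k x \<Longrightarrow> F q k y \<Longrightarrow> F q k (x - y)"
  using F_add[of q k x "- y"] F_scale[of q k y "-1"] by simp

lemma F_sum: "(\<And>n. n \<in> A \<Longrightarrow> F q k (f n)) \<Longrightarrow> F q k (sum f A)"
  by (induction A rule: infinite_finite_induct) (auto intro: F_zero F_add)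

lemma F_mono:
  assumes "F q k x" "k \<le> k'"
  shows "F q k' x"
  using assms
proof (induction arbitrary: k' rule: F.induct)
  case (F_L m q k x)
  have "F q (k' - m - 1) x" by (rule F_L.IH) (use F_L.prems in auto)
  from F.F_L[OF F_L.hyps(1) this] show ?case by simp
qed (auto intro: F.intros)

lemma F_trivial:
  assumes "F q k x" "q < 0 \<or> k \<le> 0"
  shows "x = 0"
  using assms by (induction rule: F.induct) (auto simp: i.zero l.zero)

lemma F_I': "m > 0 \<Longrightarrow> F q k x \<Longrightarrow> q' = q + m \<Longrightarrow> k \<le> k' \<Longrightarrow> F q' k' (i (- m) x)"
  by (blast intro: F_mono F_I)

lemma F_L': "m > 0 \<Longrightarrow> F q k x \<Longrightarrow> q' = q + m \<Longrightarrow> k + m + 1 \<le> k' \<Longrightarrow> F q' k' (l (- m) x)"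
  by (blast intro: F_mono F_L)

lemma F_i_pos:
  assumes "F q k x" "n > 0"
  shows "F (q - n) (k - n - 1) (i n x)"
  using assms
proof (induction arbitrary: n rule: F.induct)
  case (F_I m q k x)
  have "F (q + m - n) (k - n - 1) (i (- m) (i n x))"
    by (rule F_I'[OF F_I.hyps(1) F_I.IH[OF F_I.prems]]) auto
  thus ?case by (simp add: i_i[of n])
next
  case (F_L m q k x)
  have *: "F (q + m - n) (k + m + 1 - n - 1) (l (- m) (i n x))"
    by (rule F_L'[OF F_L.hyps(1) F_L.IH[OF F_L.prems]]) auto
  consider "n < m" | "n = m" | "n > m" by linarith
  thus ?case
  proof cases
    case 1
    have "F (q + m - n) (k + m + 1 - n - 1) (i (- (m - n)) x)"
      by (rule F_I'[OF _ F_L.hyps(2)]) (use 1 in auto)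
    thus ?thesis using * 1 by (auto simp: i_l[of n] intro!: F_add F_scale)
  next
    case 2
    have "F (q + m - n) (k + m + 1 - n - 1) (scale (of_int n * c * (of_int n - of_nat p)) x)"
      using 2 F_L.hyps(2) by (auto intro: F_scale)
    from F_add[OF * this] 2 show ?thesis using i_l_same[of n x] by simp
  next
    case 3
    have "F (q - (n - m)) (k - (n - m) - 1) (i (n - m) x)"
      by (rule F_L.IH) (use 3 in auto)
    hence "F (q - (n - m)) (k + m + 1 - n - 1) (i (n - m) x)"
      by (rule F_mono) (use F_L.hyps(1) in auto)
    moreover have "q - (n - m) = q + m - n" by simp
    ultimately have "F (q + m - n) (k + m + 1 - n - 1) (i (n - m) x)" by simp
    thus ?thesis using * 3 by (auto simp: i_l[of n] intro!: F_add F_scale)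
  qed
qed (auto simp: i_pos i.zero i.add i.scale intro: F.intros)

lemma F_l_0: "F q k x \<Longrightarrow> l 0 x = scale (h + of_int q) x"
proof (induction rule: F.induct)
  case (F_L m q k x)
  thus ?case by (simp add: l_l[of 0] l.scale algebra_simps flip: scale_left_distrib)
next
  case (F_I m q k x)
  thus ?case by (simp add: l_i[of 0] i.scale algebra_simps flip: scale_left_distrib)
qed (simp_all add: l_0 l.zero l.add l.scale scale_right_distrib scale_left_commute)

definition e :: "int \<Rightarrow> complex" where
  "e n = (of_int n + 1) / (of_int n * c * (of_int n - of_nat p))"

definition E :: "'v \<Rightarrow> 'v" where
  "E x = (\<Sum>n=1..<int p. scale (e n) (l (- n) (i n x)))"

lemma E_zero: "E 0 = 0"
  by (simp add: E_def i.zero l.zero)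

lemma E_add: "E (x + y) = E x + E y"
  by (simp add: E_def i.add l.add scale_right_distrib sum.distrib)

lemma E_scale: "E (scale a x) = scale a (E x)"
  by (simp add: E_def i.scale l.scale scale_sum_right mult.commute)

lemma E_L_step:
  assumes "0 < m" "m < int p"
  shows "E (l (- m) x) = l (- m) (E x) + scale (of_int m + 1) (l (- m) x)
    + (\<Sum>n=1..<int p. scale (e n * of_int (m - n)) (l (- (m + n)) (i n x)))
    + (\<Sum>n\<in>{1..<int p} - {m}. scale (e n * of_int n) (l (- n) (i (n - m) x)))"
proof -
  let ?A = "{1..<int p}"
  let ?r = "\<lambda>n. scale (e n) (if n = m then scale (of_int n * c * (of_int n - of_nat p)) (l (- m) x)
      else scale (of_int n) (l (- n) (i (n - m) x)))"
  have *: "l (- n) (i n (l (- m) x)) = l (- m) (l (- n) (i n x))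
      + scale (of_int (m - n)) (l (- (m + n)) (i n x))
      + (if n = m then scale (of_int n * c * (of_int n - of_nat p)) (l (- m) x)
         else scale (of_int n) (l (- n) (i (n - m) x)))" if "n \<in> ?A" for n
  proof (cases "n = m")
    case True
    thus ?thesis by (simp add: i_l_same l.add l.scale l_l)
  next
    case False
    thus ?thesis using that assms l_l[of "- n" "- m"]
      by (simp add: i_l[of n] l.add l.scale algebra_simps)
  qed
  have "E (l (- m) x) = (\<Sum>n\<in>?A. scale (e n) (l (- m) (l (- n) (i n x))))
      + (\<Sum>n\<in>?A. scale (e n * of_int (m - n)) (l (- (m + n)) (i n x))) + (\<Sum>n\<in>?A. ?r n)"
    unfolding E_def by (simp add: * scale_right_distrib flip: sum.distrib)
  moreover have "(\<Sum>n\<in>?A. scale (e n) (l (- m) (l (- n) (i n x)))) = l (- m) (E x)"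
    by (simp add: E_def l.sum l.scale)
  moreover have "(\<Sum>n\<in>?A. ?r n) = ?r m + (\<Sum>n\<in>?A - {m}. ?r n)"
    by (rule sum.remove) (use assms in auto)
  moreover have "?r m = scale (of_int m + 1) (l (- m) x)"
  proof -
    have "of_int m - of_nat p \<noteq> (0::complex)"
      using assms by (metis eq_iff_diff_eq_0 less_irrefl of_int_eq_iff of_int_of_nat_eq)
    thus ?thesis using assms c_nonzero by (simp add: e_def)
  qed
  moreover have "(\<Sum>n\<in>?A - {m}. ?r n)
      = (\<Sum>n\<in>?A - {m}. scale (e n * of_int n) (l (- n) (i (n - m) x)))"
    by (rule sum.cong) auto
  ultimately show ?thesis by (simp add: algebra_simps)
qed

lemma F_weight_0:
  assumes "F q k x" "q \<le> 0"
  shows "\<exists>a. x = scale a v"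
  using assms
proof (induction rule: F.induct)
  case (F_zero q k)
  show ?case by (rule exI[of _ 0]) simp
next
  case (F_vac k)
  show ?case by (rule exI[of _ 1]) simp
next
  case (F_add q k x y)
  thus ?case by (metis scale_left_distrib)
next
  case (F_scale q k x a)
  thus ?case by (metis scale_scale)
next
  case (F_I m q k x)
  hence "x = 0" by (intro F_trivial) auto
  thus ?case by (intro exI[of _ 0]) (simp add: i.zero)
next
  case (F_L m q k x)
  hence "x = 0" by (intro F_trivial) auto
  thus ?case by (intro exI[of _ 0]) (simp add: l.zero)
qed

lemma E_vac: "E v = 0"
  by (simp add: E_def i_pos l.zero)

lemma E_I_step:
  assumes "m > 0"
  shows "E (i (- m) x) = i (- m) (E x)
    + (\<Sum>n=1..<int p. scale (e n * of_int m) (i (- (n + m)) (i n x)))"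
proof -
  have *: "l (- n) (i n (i (- m) x)) = i (- m) (l (- n) (i n x)) + scale (of_int m) (i (- (n + m)) (i n x))"
    if "n \<in> {1..<int p}" for n
    using that assms by (simp add: i_i[of n] l_i[of "- n"])
  show ?thesis
    unfolding E_def by (simp add: * i.sum i.scale scale_right_distrib sum.distrib)
qed

lemma F_E_I:
  assumes "m > 0" "F q k x" "F q (k - 1) (E x - scale (of_int (k - 1)) x)"
  shows "F (q + m) (k - 1) (E (i (- m) x) - scale (of_int (k - 1)) (i (- m) x))"
proof -
  have "F (q + m) (k - 1) (i (- m) (E x - scale (of_int (k - 1)) x))"
    by (rule F_I[OF assms(1,3)])
  moreover have "F (q + m) (k - 1) (\<Sum>n=1..<int p. scale (e n * of_int m) (i (- (n + m)) (i n x)))"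
  proof (rule F_sum, rule F_scale)
    fix n assume "n \<in> {1..<int p}"
    thus "F (q + m) (k - 1) (i (- (n + m)) (i n x))"
      using assms(1) by (intro F_I'[OF _ F_i_pos[OF assms(2), of n]]) auto
  qed
  ultimately have "F (q + m) (k - 1) (i (- m) (E x - scale (of_int (k - 1)) x)
      + (\<Sum>n=1..<int p. scale (e n * of_int m) (i (- (n + m)) (i n x))))"
    by (rule F_add)
  thus ?thesis using assms(1) unfolding E_I_step[OF assms(1)] i.diff i.scale by (simp add: algebra_simps)
qed

lemma F_E_L:
  assumes m: "0 < m" "m < int p" and x: "F q k x" "F q (k - 1) (E x - scale (of_int (k - 1)) x)"
  shows "F (q + m) (k + m) (E (l (- m) x) - scale (of_int (k + m)) (l (- m) x))"
proof -
  let ?S1 = "\<Sum>n=1..<int p. scale (e n * of_int (m - n)) (l (- (m + n)) (i n x))"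
  let ?S2 = "\<Sum>n\<in>{1..<int p} - {m}. scale (e n * of_int n) (l (- n) (i (n - m) x))"
  have "F (q + m) (k + m) (l (- m) (E x - scale (of_int (k - 1)) x))"
    by (rule F_L'[OF m(1) x(2)]) auto
  moreover have "F (q + m) (k + m) ?S1"
  proof (rule F_sum, rule F_scale)
    fix n assume "n \<in> {1..<int p}"
    thus "F (q + m) (k + m) (l (- (m + n)) (i n x))"
      using m by (intro F_L'[OF _ F_i_pos[OF x(1), of n]]) auto
  qed
  moreover have "F (q + m) (k + m) ?S2"
  proof (rule F_sum, rule F_scale)
    fix n assume n: "n \<in> {1..<int p} - {m}"
    show "F (q + m) (k + m) (l (- n) (i (n - m) x))"
    proof (cases "n > m")
      case True
      thus ?thesis using m by (intro F_L'[OF _ F_i_pos[OF x(1), of "n - m"]]) auto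
    next
      case False
      with n have "F (q + m - n) k (i (- (m - n)) x)"
        by (intro F_I'[OF _ x(1)]) auto
      hence "F (q + m) (k + m) (l (- n) (i (- (m - n)) x))"
        using n False by (intro F_L') auto
      thus ?thesis by simp
    qed
  qed
  ultimately have "F (q + m) (k + m) (l (- m) (E x - scale (of_int (k - 1)) x) + ?S1 + ?S2)"
    by (intro F_add)
  moreover have "l (- m) (E x - scale (of_int (k - 1)) x) + ?S1 + ?S2
      = E (l (- m) x) - scale (of_int (k + m)) (l (- m) x)"
    unfolding E_L_step[OF m] l.diff l.scale by (simp add: scale_left_distrib scale_left_diff_distrib)
  ultimately show ?thesis by simp
qed

lemma F_E_L_p: "F (int p) (int p + 1) (E (l (- int p) v))"
proof -
  have "E (l (- int p) v) = (\<Sum>n=1..<int p. scale (e n * of_int n) (l (- n) (i (- (int p - n)) v)))"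
    unfolding E_def by (rule sum.cong) (simp_all add: i_l i_pos l.scale l.zero)
  also have "F (int p) (int p + 1) \<dots>"
  proof (rule F_sum, rule F_scale)
    fix n assume n: "n \<in> {1..<int p}"
    have "F (int p - n) 1 (i (- (int p - n)) v)"
      by (rule F_I'[OF _ F_vac[of 1]]) (use n in auto)
    thus "F (int p) (int p + 1) (l (- n) (i (- (int p - n)) v))"
      by (rule F_L'[rotated]) (use n in auto)
  qed
  finally show ?thesis .
qed

text \<open>\<open>E\<close> acts on the graded pieces by the degree, except that it does not see the
  letter \<open>l (- p)\<close>: there the coefficient of \<open>i p (l (- p) x)\<close> vanishes.\<close>

lemma F_E:
  assumes "F q k x" "q \<le> int p"
  shows "\<exists>a. F q (k - 1) (E x - scale (of_int (k - 1)) x + scale a (l (- int p) v))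
    \<and> (a \<noteq> 0 \<longrightarrow> q = int p \<and> k \<ge> int p + 2)"
  using assms
proof (induction rule: F.induct)
  case (F_zero q k)
  show ?case by (rule exI[of _ 0]) (simp add: E_zero F.F_zero)
next
  case (F_vac k)
  have "F 0 (k - 1) (scale (of_int (k - 1)) v)"
  proof (cases "k = 1")
    case False
    thus ?thesis using F_vac by (intro F_scale F.F_vac) auto
  qed (simp add: F_zero)
  hence "F 0 (k - 1) (0 - scale (of_int (k - 1)) v)"
    by (rule F_diff[OF F_zero])
  thus ?case by (intro exI[of _ 0]) (simp add: E_vac)
next
  case (F_add q k x y)
  then obtain a b where
    a: "F q (k - 1) (E x - scale (of_int (k - 1)) x + scale a (l (- int p) v))"
      "a \<noteq> 0 \<longrightarrow> q = int p \<and> k \<ge> int p + 2" and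
    b: "F q (k - 1) (E y - scale (of_int (k - 1)) y + scale b (l (- int p) v))"
      "b \<noteq> 0 \<longrightarrow> q = int p \<and> k \<ge> int p + 2" by blast
  have "E (x + y) - scale (of_int (k - 1)) (x + y) + scale (a + b) (l (- int p) v)
      = (E x - scale (of_int (k - 1)) x + scale a (l (- int p) v))
      + (E y - scale (of_int (k - 1)) y + scale b (l (- int p) v))"
    by (simp only: E_add scale_left_distrib scale_right_distrib) (simp add: algebra_simps)
  with F.F_add[OF a(1) b(1)] a(2) b(2) show ?case by (intro exI[of _ "a + b"]) auto
next
  case (F_scale q k x b)
  then obtain a where
    a: "F q (k - 1) (E x - scale (of_int (k - 1)) x + scale a (l (- int p) v))"
      "a \<noteq> 0 \<longrightarrow> q = int p \<and> k \<ge> int p + 2" by blast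
  have "E (scale b x) - scale (of_int (k - 1)) (scale b x) + scale (b * a) (l (- int p) v)
      = scale b (E x - scale (of_int (k - 1)) x + scale a (l (- int p) v))"
    by (simp add: E_scale scale_right_distrib scale_right_diff_distrib mult.commute)
  with F.F_scale[OF a(1)] a(2) show ?case by (intro exI[of _ "b * a"]) auto
next
  case (F_I m q k x)
  then obtain a where
    a: "F q (k - 1) (E x - scale (of_int (k - 1)) x + scale a (l (- int p) v))"
      "a \<noteq> 0 \<longrightarrow> q = int p \<and> k \<ge> int p + 2" by force
  with F_I have "a = 0" by auto
  with a have "F q (k - 1) (E x - scale (of_int (k - 1)) x)" by simp
  from F_E_I[OF F_I.hyps this] show ?case by (intro exI[of _ 0]) simp
next
  case (F_L m q k x)
  then obtain a where
    a: "F q (k - 1) (E x - scale (of_int (k - 1)) x + scale a (l (- int p) v))"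
      "a \<noteq> 0 \<longrightarrow> q = int p \<and> k \<ge> int p + 2" by force
  with F_L have "a = 0" by auto
  with a have x: "F q (k - 1) (E x - scale (of_int (k - 1)) x)" by simp
  consider "x = 0" | "q \<ge> 0" "k \<ge> 1" using F_trivial[OF F_L.hyps(2)] by fastforce
  thus ?case
  proof cases
    case 1
    thus ?thesis by (intro exI[of _ 0]) (simp add: l.zero E_zero F_zero)
  next
    case 2
    show ?thesis
    proof (cases "m < int p")
      case True
      from F_E_L[OF F_L.hyps(1) True F_L.hyps(2) x] show ?thesis by (intro exI[of _ 0]) simp
    next
      case False
      with 2 F_L.prems have m: "m = int p" "q = 0" by auto
      with F_weight_0[OF F_L.hyps(2)] obtain b where b: "x = scale b v" by auto
      have "F (int p) (k + int p) (E (l (- int p) v))"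
        by (rule F_mono[OF F_E_L_p]) (use 2 in auto)
      from F_scale[OF this, of b] have "F (q + m) (k + m) (E (l (- m) x))"
        by (simp add: b m l.scale E_scale)
      moreover have "scale (of_int (k + m) * b) (l (- int p) v) = scale (of_int (k + m)) (l (- m) x)"
        by (simp add: b m l.scale)
      ultimately show ?thesis using 2 m
        by (intro exI[of _ "of_int (k + m) * b"]) simp
    qed
  qed
qed

definition s :: 'v where
  "s = (\<Sum>j=0..p - 1. cpoly_act scale (\<lambda>n w. scale (1 / c) (i (- int n) w)) (schur j)
     (l (int j - int p) v))"

lemma F_schur:
  assumes "F q k x"
  shows "F (q + int r) k (cpoly_act scale (\<lambda>n w. scale (1 / c) (i (- int n) w)) (schur r) x)"
    (is "F _ _ (?S r x)")
proof (induction r rule: less_induct)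
  case (less r)
  show ?case
  proof (cases r)
    case 0
    thus ?thesis using assms by (simp add: schur_0 schur.cpoly_act_1)
  next
    case (Suc t)
    have "F (q + int r) k (\<Sum>j\<le>t. scale (1 / c) (i (- int (Suc j)) (?S (t - j) x)))"
    proof (rule F_sum, rule F_scale)
      fix j assume "j \<in> {..t}"
      thus "F (q + int r) k (i (- int (Suc j)) (?S (t - j) x))"
        using Suc by (intro F_I'[OF _ less.IH[of "t - j"]]) auto
    qed
    hence "F (q + int r) k (scale (1 / of_nat r) (scale (of_nat r) (?S r x)))"
      unfolding Suc schur.schur_act_newton by (rule F_scale)
    thus ?thesis using Suc by (simp del: of_nat_Suc)
  qed
qed

lemma F_s_minus: "F (int p) (int p + 1) (s - l (- int p) v)"
proof -
  let ?S = "\<lambda>j. cpoly_act scale (\<lambda>n w. scale (1 / c) (i (- int n) w)) (schur j)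
     (l (int j - int p) v)"
  have "s = ?S 0 + (\<Sum>j=1..p - 1. ?S j)"
    unfolding s_def by (subst sum.atLeast_Suc_atMost) auto
  hence "s - l (- int p) v = (\<Sum>j=1..p - 1. ?S j)"
    by (simp add: schur_0 schur.cpoly_act_1)
  also have "F (int p) (int p + 1) \<dots>"
  proof (rule F_sum)
    fix j assume j: "j \<in> {1..p - 1}"
    have "F (int p - int j) (int p + 1) (l (- (int p - int j)) v)"
      by (rule F_L'[OF _ F_vac[of 1]]) (use j p_pos in auto)
    from F_schur[OF this, of j] show "F (int p) (int p + 1) (?S j)" by simp
  qed
  finally show ?thesis .
qed

lemma i_schur:
  "i n (cpoly_act scale (\<lambda>n w. scale (1 / c) (i (- int n) w)) P x)
     = cpoly_act scale (\<lambda>n w. scale (1 / c) (i (- int n) w)) P (i n x)"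
  by (rule schur.cpoly_act_commute[OF i_linear]) (simp add: i.scale i_i[of n])

lemma i_s:
  assumes "n > 0"
  shows "i n s = 0"
proof -
  let ?S = "\<lambda>j. cpoly_act scale (\<lambda>n w. scale (1 / c) (i (- int n) w)) (schur j)"
  have S_scale: "?S j (scale a x) = scale a (?S j x)" for j a x
    by (rule schur.cpoly_act_commute[symmetric])
      (simp_all add: i.scale mult.commute linear_scale_self)
  have S_0: "?S j 0 = 0" for j using S_scale[of j 0 0] by simp
  have eq: "i n s = (\<Sum>j=0..p - 1. ?S j (i n (l (int j - int p) v)))"
    by (simp add: s_def i.sum i_schur)
  have *: "i n (l (int j - int p) v) = (if n + int j > int p then 0
      else if n + int j = int p then scale (of_int n * c * (of_int n - of_nat p)) v
      else scale (of_int n) (i (n + int j - int p) v))" for j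
    using assms i_l_same[of n v] by (auto simp: i_l[of n] i_pos l.zero algebra_simps)
  show ?thesis
  proof (cases "n > int p")
    case True
    thus ?thesis unfolding eq by (intro sum.neutral) (auto simp: * S_0)
  next
    case False
    define r where "r = p - nat n"
    have r: "n = int p - int r" "r < p" using False assms by (auto simp: r_def)
    have zero: "i n (l (int j - int p) v) = 0" if "j > r" for j
      unfolding * using that r by simp
    have below: "i n (l (int j - int p) v) = scale (of_int n) (i (- int (r - j)) v)" if "j < r" for j
      unfolding * using that r by (simp add: of_nat_diff)
    have at: "i n (l (int r - int p) v) = scale (- (of_int n * c * of_nat r)) v"
      unfolding * using r by simp
    have "i n s = (\<Sum>j\<le>r. ?S j (i n (l (int j - int p) v)))"
      unfolding eq
      by (rule sum.mono_neutral_right) (use r(2) in \<open>auto simp: zero S_0 not_le\<close>)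
    also have "\<dots> = (\<Sum>j<r. ?S j (scale (of_int n) (i (- int (r - j)) v)))
        + scale (- (of_int n * c * of_nat r)) (?S r v)"
      unfolding lessThan_Suc_atMost[symmetric] sum.lessThan_Suc at S_scale
      by (simp add: below S_scale)
    also have "scale (- (of_int n * c * of_nat r)) (?S r v)
        = scale (- (of_int n * c)) (scale (of_nat r) (?S r v))" by simp
    also have "scale (of_nat r) (?S r v) = (\<Sum>j<r. scale (1 / c) (i (- int (r - j)) (?S j v)))"
    proof (cases r)
      case (Suc t)
      have "scale (of_nat r) (?S r v) = (\<Sum>j\<le>t. scale (1 / c) (i (- int (Suc j)) (?S (t - j) v)))"
        unfolding Suc by (rule schur.schur_act_newton)
      also have "\<dots> = (\<Sum>j\<le>t. scale (1 / c) (i (- int (r - j)) (?S j v)))"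
        by (rule sum.reindex_bij_witness[of _ "\<lambda>j. t - j" "\<lambda>j. t - j"]) (auto simp: Suc)
      finally show ?thesis by (simp add: Suc lessThan_Suc_atMost)
    qed simp
    also have "scale (- (of_int n * c)) \<dots> = - (\<Sum>j<r. ?S j (scale (of_int n) (i (- int (r - j)) v)))"
      using c_nonzero by (simp add: scale_sum_right S_scale i_schur sum_negf)
    finally show ?thesis by simp
  qed
qed

lemma annihilated_imp_s:
  assumes "F (int p) k x" "\<And>n. n > 0 \<Longrightarrow> i n x = 0"
  shows "\<exists>a. F (int p) 1 (x - scale a s)"
  using assms
proof (induction "nat k" arbitrary: k x rule: less_induct)
  case less
  show ?case
  proof (cases "k \<le> 1")
    case True
    from F_mono[OF less.prems(1) this] show ?thesis by (intro exI[of _ 0]) simp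
  next
    case False
    have "E x = 0" by (simp add: E_def less.prems(2) l.zero)
    with F_E[OF less.prems(1)] obtain a where
      a: "F (int p) (k - 1) (- scale (of_int (k - 1)) x + scale a (l (- int p) v))"
        "a \<noteq> 0 \<longrightarrow> k \<ge> int p + 2" by auto
    define b where "b = a / of_int (k - 1)"
    have k: "of_int (k - 1) \<noteq> (0::complex)" using False by (simp only: of_int_eq_0_iff)
    have "F (int p) (k - 1) (scale (- 1 / of_int (k - 1))
        (- scale (of_int (k - 1)) x + scale a (l (- int p) v)))"
      by (rule F_scale[OF a(1)])
    also have "scale (- 1 / of_int (k - 1)) (- scale (of_int (k - 1)) x + scale a (l (- int p) v))
        = x - scale b (l (- int p) v)"
      using k by (simp add: scale_right_diff_distrib b_def del: of_int_diff)
    finally have 1: "F (int p) (k - 1) (x - scale b (l (- int p) v))" .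
    have 2: "F (int p) (k - 1) (scale b (s - l (- int p) v))"
    proof (cases "a = 0")
      case False
      with a(2) show ?thesis by (intro F_scale F_mono[OF F_s_minus]) auto
    qed (simp add: b_def F_zero)
    have "F (int p) (k - 1) (x - scale b s)"
      using F_diff[OF 1 2] by (simp add: scale_right_diff_distrib)
    with False less.prems(2) obtain a' where "F (int p) 1 (x - scale b s - scale a' s)"
      using less.hyps[of "k - 1" "x - scale b s"] by (auto simp: i.diff i.scale i_s)
    thus ?thesis by (intro exI[of _ "b + a'"]) (simp add: scale_left_distrib algebra_simps)
  qed
qed

inductive G :: "int \<Rightarrow> int \<Rightarrow> 'v \<Rightarrow> bool" where
  G_zero: "G q r 0"
| G_vac: "r \<le> 0 \<Longrightarrow> G 0 r v"
| G_add: "G q r x \<Longrightarrow> G q r y \<Longrightarrow> G q r (x + y)"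
| G_scale: "G q r x \<Longrightarrow> G q r (scale a x)"
| G_I: "m > 0 \<Longrightarrow> G q r x \<Longrightarrow> G (q + m) (r + 1) (i (- m) x)"

lemma G_sum: "(\<And>n. n \<in> A \<Longrightarrow> G q r (f n)) \<Longrightarrow> G q r (sum f A)"
  by (induction A rule: infinite_finite_induct) (auto intro: G_zero G_add)

lemma G_mono:
  assumes "G q r x" "r' \<le> r"
  shows "G q r' x"
  using assms
proof (induction arbitrary: r' rule: G.induct)
  case (G_I m q r x)
  have "G q (r' - 1) x" by (rule G_I.IH) (use G_I.prems in auto)
  from G.G_I[OF G_I.hyps(1) this] show ?case by simp
qed (auto intro: G.intros)

lemma G_trivial:
  assumes "G q r x" "q < 0 \<or> q < r"
  shows "x = 0"
  using assms by (induction rule: G.induct) (auto simp: i.zero)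

lemma G_i_pos: "G q r x \<Longrightarrow> n > 0 \<Longrightarrow> i n x = 0"
  by (induction rule: G.induct) (auto simp: i.zero i_pos i.add i.scale i_i[of n])

lemma F_imp_G:
  assumes "F q k x" "k \<le> 1"
  shows "G q 0 x"
  using assms
proof (induction rule: F.induct)
  case (F_I m q k x)
  thus ?case using G_mono[OF G_I[of m q 0 x], of 0] by auto
next
  case (F_L m q k x)
  hence "x = 0" by (intro F_trivial[of q k]) auto
  thus ?case by (simp add: l.zero G_zero)
qed (auto intro: G.intros)

definition D :: "'v \<Rightarrow> 'v" where
  "D x = (\<Sum>n=1..int p. scale (- 1 / (c * (of_int n + of_nat p))) (i (- n) (l n x)))"

lemma D_add: "D (x + y) = D x + D y"
  by (simp only: D_def l.add i.add scale_right_distrib sum.distrib)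

lemma D_I_step:
  assumes "0 < m" "m \<le> int p"
  shows "D (i (- m) x) = i (- m) (D x) + scale (of_int m) (i (- m) x)
    + (\<Sum>n\<in>{1..int p} - {m}. scale (- of_int m / (c * (of_int n + of_nat p)))
        (i (- n) (i (n - m) x)))"
proof -
  let ?A = "{1..int p}"
  let ?d = "\<lambda>n. - 1 / (c * (of_int n + of_nat p))"
  let ?r = "\<lambda>n. scale (?d n) (if n = m then - scale (of_int n * c * (of_int n + of_nat p)) (i (- m) x)
      else scale (of_int m) (i (- n) (i (n - m) x)))"
  have *: "i (- n) (l n (i (- m) x)) = i (- m) (i (- n) (l n x))
      + (if n = m then - scale (of_int n * c * (of_int n + of_nat p)) (i (- m) x)
         else scale (of_int m) (i (- n) (i (n - m) x)))" for n
  proof (cases "n = m")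
    case True
    thus ?thesis by (simp add: l_i_same i.diff i.scale)
  next
    case False
    thus ?thesis
      by (simp add: l_i[of n] i.diff i.add i.scale i.neg i_i[of "- n" "- m"])
  qed
  have "D (i (- m) x) = (\<Sum>n\<in>?A. scale (?d n) (i (- m) (i (- n) (l n x)))) + (\<Sum>n\<in>?A. ?r n)"
    unfolding D_def * scale_right_distrib sum.distrib ..
  moreover have "(\<Sum>n\<in>?A. scale (?d n) (i (- m) (i (- n) (l n x)))) = i (- m) (D x)"
    by (simp add: D_def i.sum i.scale i.neg)
  moreover have "(\<Sum>n\<in>?A. ?r n) = ?r m + (\<Sum>n\<in>?A - {m}. ?r n)"
    by (rule sum.remove) (use assms in auto)
  moreover have "?r m = scale (of_int m) (i (- m) x)"
  proof -
    have "of_int m + of_nat p \<noteq> (0::complex)"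
      using assms by (metis add_pos_nonneg less_irrefl of_int_0_eq_iff of_int_add of_int_of_nat_eq
          of_nat_0_le_iff)
    thus ?thesis using assms c_nonzero by simp
  qed
  moreover have "(\<Sum>n\<in>?A - {m}. ?r n) = (\<Sum>n\<in>?A - {m}.
      scale (- of_int m / (c * (of_int n + of_nat p))) (i (- n) (i (n - m) x)))"
    by (rule sum.cong) auto
  ultimately show ?thesis by (simp add: algebra_simps)
qed

lemma G_D:
  assumes "G q r x" "q \<le> int p"
  shows "G q (r + 1) (D x - scale (of_int q) x)"
  using assms
proof (induction rule: G.induct)
  case (G_add q r x y)
  have "D (x + y) - scale (of_int q) (x + y) = (D x - scale (of_int q) x) + (D y - scale (of_int q) y)"
    by (simp add: D_add scale_right_distrib)
  thus ?case using G_add by (auto intro: G.G_add)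
next
  case (G_scale q r x a)
  have "D (scale a x) - scale (of_int q) (scale a x) = scale a (D x - scale (of_int q) x)"
    by (simp add: D_def l.scale i.scale scale_right_diff_distrib scale_sum_right mult.commute)
  thus ?case using G_scale by (auto intro: G.G_scale)
next
  case (G_I m q r x)
  show ?case
  proof (cases "q < 0")
    case True
    with G_I have "x = 0" by (auto intro: G_trivial)
    thus ?thesis by (simp add: D_def i.zero l.zero G_zero)
  next
    case False
    let ?S = "\<Sum>n\<in>{1..int p} - {m}. scale (- of_int m / (c * (of_int n + of_nat p)))
        (i (- n) (i (n - m) x))"
    have "G (q + m) (r + 1 + 1) (i (- m) (D x - scale (of_int q) x))"
      using G_I by (intro G.G_I) auto
    moreover have "G (q + m) (r + 1 + 1) ?S"
    proof (rule G_sum, rule G_scale)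
      fix n assume n: "n \<in> {1..int p} - {m}"
      show "G (q + m) (r + 1 + 1) (i (- n) (i (n - m) x))"
      proof (cases "n > m")
        case True
        thus ?thesis using G_i_pos[OF G_I.hyps(2), of "n - m"] by (simp add: i.zero G_zero)
      next
        case False
        with n have "G (q + (m - n) + n) (r + 1 + 1) (i (- n) (i (- (m - n)) x))"
          by (intro G.G_I G_I.hyps) auto
        thus ?thesis by simp
      qed
    qed
    ultimately have "G (q + m) (r + 1 + 1) (i (- m) (D x - scale (of_int q) x) + ?S)"
      by (rule G.G_add)
    moreover have "i (- m) (D x - scale (of_int q) x) + ?S
        = D (i (- m) x) - scale (of_int (q + m)) (i (- m) x)"
      using D_I_step[of m x] G_I False
      by (simp add: i.diff i.scale scale_left_distrib)
    ultimately show ?thesis by simp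
  qed
qed (auto simp: D_def l.zero i.zero l_pos G_zero)

lemma annihilated_I_zero:
  assumes "F (int p) 1 x" "\<And>n. n > 0 \<Longrightarrow> l n x = 0"
  shows "x = 0"
proof -
  have "D x = 0" by (simp add: D_def assms(2) i.zero)
  have "G (int p) (int r) x" for r
  proof (induction r)
    case 0
    show ?case using F_imp_G[OF assms(1)] by simp
  next
    case (Suc r)
    from G_D[OF this] have "G (int p) (int r + 1) (scale (- 1 / of_nat p) (- scale (of_nat p) x))"
      by (intro G_scale) (simp add: \<open>D x = 0\<close>)
    thus ?case using p_pos by (simp add: add.commute)
  qed
  from G_trivial[OF this[of "Suc p"]] show ?thesis by simp
qed

lemma F_imp_cpoly_act:
  assumes "F q k x" "k \<le> 1"
  shows "\<exists>P. (\<forall>m\<in>Poly_Mapping.keys P. 0 \<notin> Poly_Mapping.keys m)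
    \<and> x = cpoly_act scale (\<lambda>n. i (- int n)) P v"
  using assms
proof (induction rule: F.induct)
  case (F_zero q k)
  show ?case by (rule exI[of _ 0]) (simp add: Ipoly.cpoly_act_0)
next
  case (F_vac k)
  have "Poly_Mapping.keys (1::cpoly) = {0}" by (simp flip: single_one)
  thus ?case by (intro exI[of _ 1]) (simp add: Ipoly.cpoly_act_1)
next
  case (F_add q k x y)
  then obtain P Q where
    "\<forall>m\<in>Poly_Mapping.keys P. 0 \<notin> Poly_Mapping.keys m" "x = cpoly_act scale (\<lambda>n. i (- int n)) P v"
    "\<forall>m\<in>Poly_Mapping.keys Q. 0 \<notin> Poly_Mapping.keys m" "y = cpoly_act scale (\<lambda>n. i (- int n)) Q v"
    by auto
  thus ?case using keys_add[of P Q]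
    by (intro exI[of _ "P + Q"]) (auto simp: Ipoly.cpoly_act_add)
next
  case (F_scale q k x a)
  then obtain P where
    P: "\<forall>m\<in>Poly_Mapping.keys P. 0 \<notin> Poly_Mapping.keys m" "x = cpoly_act scale (\<lambda>n. i (- int n)) P v"
    by auto
  have "Poly_Mapping.keys (cpoly_const a * P) \<subseteq> Poly_Mapping.keys P"
    using keys_mult[of "cpoly_const a" P] by (auto simp: cpoly_const_def split: if_splits)
  with P show ?case
    by (intro exI[of _ "cpoly_const a * P"]) (auto simp: Ipoly.cpoly_act_const_mult)
next
  case (F_I m q k x)
  then obtain P where
    P: "\<forall>m\<in>Poly_Mapping.keys P. 0 \<notin> Poly_Mapping.keys m" "x = cpoly_act scale (\<lambda>n. i (- int n)) P v"
    by auto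
  have "0 \<notin> Poly_Mapping.keys m'" if "m' \<in> Poly_Mapping.keys (cpoly_var (nat m) * P)" for m'
  proof -
    from that keys_mult[of "cpoly_var (nat m)" P] obtain m'' where
      m'': "m'' \<in> Poly_Mapping.keys P" "m' = Poly_Mapping.single (nat m) 1 + m''"
      by (auto simp: cpoly_var_def)
    thus ?thesis using P(1) F_I.hyps(1) by (auto simp: in_keys_iff lookup_add lookup_single)
  qed
  moreover have "i (- m) x = cpoly_act scale (\<lambda>n. i (- int n)) (cpoly_var (nat m) * P) v"
    using P(2) F_I.hyps(1) by (simp add: Ipoly.cpoly_act_var_mult)
  ultimately show ?case by blast
next
  case (F_L m q k x)
  hence "x = 0" by (intro F_trivial[of q k]) auto
  thus ?case by (intro exI[of _ 0]) (simp add: Ipoly.cpoly_act_0 l.zero)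
qed

lemma sum_of_homogeneous:
  "\<exists>ws. w = sum_list ws \<and> (\<forall>x\<in>set ws. \<exists>q k. F q k x)"
proof (rule generated[where P = "\<lambda>w. \<exists>ws. w = sum_list ws \<and> (\<forall>x\<in>set ws. \<exists>q k. F q k x)"])
  show "\<exists>ws. v = sum_list ws \<and> (\<forall>x\<in>set ws. \<exists>q k. F q k x)"
    using F_vac[of 1] by (intro exI[of _ "[v]"]) auto
next
  fix x y
  assume "\<exists>ws. x = sum_list ws \<and> (\<forall>x\<in>set ws. \<exists>q k. F q k x)"
    "\<exists>ws. y = sum_list ws \<and> (\<forall>x\<in>set ws. \<exists>q k. F q k x)"
  then obtain xs ys where "x = sum_list xs" "\<forall>x\<in>set xs. \<exists>q k. F q k x"
    "y = sum_list ys" "\<forall>x\<in>set ys. \<exists>q k. F q k x" by blast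
  thus "\<exists>ws. x + y = sum_list ws \<and> (\<forall>x\<in>set ws. \<exists>q k. F q k x)"
    by (intro exI[of _ "xs @ ys"]) auto
next
  fix a x
  assume "\<exists>ws. x = sum_list ws \<and> (\<forall>x\<in>set ws. \<exists>q k. F q k x)"
  then obtain ws where "x = sum_list ws" "\<forall>x\<in>set ws. \<exists>q k. F q k x" by blast
  moreover have "scale a (sum_list ws) = sum_list (map (scale a) ws)"
    by (induction ws) (simp_all add: scale_right_distrib)
  ultimately show "\<exists>ws. scale a x = sum_list ws \<and> (\<forall>x\<in>set ws. \<exists>q k. F q k x)"
    by (intro exI[of _ "map (scale a) ws"]) (simp, blast intro: F_scale)
next
  fix m :: int and x
  assume "m > 0" "\<exists>ws. x = sum_list ws \<and> (\<forall>x\<in>set ws. \<exists>q k. F q k x)"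
  then obtain ws where "x = sum_list ws" "\<forall>x\<in>set ws. \<exists>q k. F q k x" by blast
  moreover have "l (- m) (sum_list ws) = sum_list (map (l (- m)) ws)"
    by (induction ws) (simp_all add: l.add l.zero)
  ultimately show "\<exists>ws. l (- m) x = sum_list ws \<and> (\<forall>x\<in>set ws. \<exists>q k. F q k x)"
    using \<open>m > 0\<close> by (intro exI[of _ "map (l (- m)) ws"]) (simp, blast intro: F_L)
next
  fix m :: int and x
  assume "m > 0" "\<exists>ws. x = sum_list ws \<and> (\<forall>x\<in>set ws. \<exists>q k. F q k x)"
  then obtain ws where "x = sum_list ws" "\<forall>x\<in>set ws. \<exists>q k. F q k x" by blast
  moreover have "i (- m) (sum_list ws) = sum_list (map (i (- m)) ws)"
    by (induction ws) (simp_all add: i.add i.zero)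
  ultimately show "\<exists>ws. i (- m) x = sum_list ws \<and> (\<forall>x\<in>set ws. \<exists>q k. F q k x)"
    using \<open>m > 0\<close> by (intro exI[of _ "map (i (- m)) ws"]) (simp, blast intro: F_I)
qed

text \<open>Applying \<open>l 0 - (h + q)\<close> removes a summand of weight \<open>q\<close> from the decomposition.\<close>

lemma weight_eigenvector_sum:
  assumes "l 0 (sum_list ws + y) = scale (h + of_int q) (sum_list ws + y)"
    "\<forall>x\<in>set ws. \<exists>q k. F q k x" "F q k y"
  shows "\<exists>k. F q k (sum_list ws + y)"
  using assms
proof (induction "length ws" arbitrary: ws y k)
  case 0
  thus ?case by auto
next
  case (Suc len)
  then obtain x ws' where ws: "ws = x # ws'" by (cases ws) auto
  with Suc.prems obtain q' k' where x: "F q' k' x" by auto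
  show ?case
  proof (cases "q' = q")
    case True
    have "F q (max k k') (x + y)"
      using x Suc.prems(3) True by (intro F_add) (auto elim: F_mono)
    with Suc.hyps(1)[of ws' "x + y" "max k k'"] Suc.hyps(2) Suc.prems show ?thesis
      by (auto simp: ws algebra_simps)
  next
    case False
    let ?f = "\<lambda>x. l 0 x - scale (h + of_int q') x"
    let ?b = "of_int (q - q') :: complex"
    let ?L = "sum_list ws + y"
    have F_f: "\<exists>a. ?f z = scale a z" if "F r t z" for r t z
      using F_l_0[OF that] by (metis scale_left_diff_distrib)
    have "?f ?L = scale ?b ?L"
      by (simp add: Suc.prems(1) flip: scale_left_diff_distrib)
    moreover have "?f ?L = sum_list (map ?f ws') + ?f y"
    proof -
      have "?f (sum_list zs) = sum_list (map ?f zs)" for zs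
        by (induction zs) (simp_all add: l.zero l.add scale_right_distrib algebra_simps)
      moreover have "?f x = 0" using F_l_0[OF x] by simp
      ultimately show ?thesis by (simp add: ws l.add scale_right_distrib algebra_simps)
    qed
    ultimately have L: "scale ?b ?L = sum_list (map ?f ws') + ?f y" by simp
    have "\<exists>k. F q k (sum_list (map ?f ws') + ?f y)"
    proof (rule Suc.hyps(1))
      show "len = length (map ?f ws')" using Suc.hyps(2) ws by simp
      show "l 0 (sum_list (map ?f ws') + ?f y) = scale (h + of_int q) (sum_list (map ?f ws') + ?f y)"
        by (simp only: L[symmetric] l.scale Suc.prems(1) scale_left_commute)
      show "\<forall>x\<in>set (map ?f ws'). \<exists>q k. F q k x"
      proof
        fix z assume "z \<in> set (map ?f ws')"
        then obtain u where u: "u \<in> set ws'" "z = ?f u" by auto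
        with Suc.prems(2) ws obtain r t where "F r t u" by auto
        with F_f[OF this] u F_scale[OF this] show "\<exists>q k. F q k z" by metis
      qed
      show "F q k (?f y)" using F_f[OF Suc.prems(3)] F_scale[OF Suc.prems(3)] by auto
    qed
    then obtain k'' where "F q k'' (scale ?b ?L)" using L by auto
    from F_scale[OF this, of "1 / ?b"] False show ?thesis by auto
  qed
qed

lemma weight_vector_homogeneous:
  assumes "l 0 x = scale (h + of_int q) x"
  shows "\<exists>k. F q k x"
proof -
  obtain ws where "x = sum_list ws" "\<forall>x\<in>set ws. \<exists>q k. F q k x"
    using sum_of_homogeneous by blast
  with weight_eigenvector_sum[of ws 0 q 0] assms show ?thesis by (simp add: F_zero)
qed

theorem singular_vector_form:
  assumes "l 0 x = scale (h + of_nat p) x" "x \<noteq> 0"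
    "\<And>n. n > 0 \<Longrightarrow> l n x = 0" "\<And>n. n > 0 \<Longrightarrow> i n x = 0"
  shows "\<exists>a y. a \<noteq> 0 \<and> F (int p) 1 y \<and> scale a x = s + y"
proof -
  obtain k where "F (int p) k x"
    using weight_vector_homogeneous[of x "int p"] assms(1) by auto
  with annihilated_imp_s assms(4) obtain b where b: "F (int p) 1 (x - scale b s)" by blast
  have "b \<noteq> 0"
    using annihilated_I_zero[of x] assms b by auto
  moreover have "F (int p) 1 (scale (1 / b) (x - scale b s))" by (rule F_scale[OF b])
  moreover have "scale (1 / b) x = s + scale (1 / b) (x - scale b s)"
    using \<open>b \<noteq> 0\<close> by (simp add: scale_right_diff_distrib)
  ultimately show ?thesis by (intro exI[of _ "1 / b"] exI conjI) auto
qed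

end

lemma hv_scale_1: "hv_scale 1 X = X"
  by (rule poly_mapping_eqI) (simp add: hv_scale_def Poly_Mapping.map.rep_eq when_def)

lemma hv_bracket_elt: "hv_bracket (hv_elt a) (hv_elt b) = hv_bracket_basis a b"
  by (simp add: hv_bracket_def hv_elt_def hv_scale_1)

lemma free_rank_one_induct:
  assumes "vector_space scale" "free_rank_one scale act B v"
    and "P v" "\<And>x y. P x \<Longrightarrow> P y \<Longrightarrow> P (x + y)" "\<And>a x. P x \<Longrightarrow> P (scale a x)"
    and "\<And>b x. b \<in> B \<Longrightarrow> P x \<Longrightarrow> P (act (hv_elt b) x)"
  shows "P w"
proof -
  interpret vector_space scale by fact
  have "P 0" using assms(5)[OF assms(3), of 0] by simp
  obtain t where t: "t \<in> tensor_algebra B" "w = tensor_act scale act t v"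
    using assms(2) unfolding free_rank_one_def by metis
  have word: "P (foldr (\<lambda>b. act (hv_elt b)) u v)" if "set u \<subseteq> B" for u
    using that by (induction u) (use assms in auto)
  have "P (\<Sum>u\<in>A. scale (f u) (foldr (\<lambda>b. act (hv_elt b)) u v))" if "\<forall>u\<in>A. set u \<subseteq> B" for f A
    using that by (induction A rule: infinite_finite_induct) (use \<open>P 0\<close> assms word in auto)
  thus ?thesis using t by (auto simp: tensor_act_def tensor_algebra_def)
qed

theorem theorem4p3:
  fixes scale :: "complex \<Rightarrow> 'v \<Rightarrow> 'v::ab_group_add"
    and act :: "hv \<Rightarrow> 'v \<Rightarrow> 'v"
    and c\<^sub>L c\<^sub>L\<^sub>I h h\<^sub>I :: complex
    and v \<Lambda> :: 'v
    and p :: nat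
  assumes "c\<^sub>L\<^sub>I \<noteq> 0"
    and "p > 0"
    and "h\<^sub>I / c\<^sub>L\<^sub>I - 1 = - of_nat p"
    and "verma_module scale act c\<^sub>L 0 c\<^sub>L\<^sub>I h h\<^sub>I v"
    and "\<Lambda> \<in> weight_component scale act h p"
    and "singular_vector scale act \<Lambda>"
  shows "\<exists>a x. a \<noteq> 0 \<and> x \<in> I_component scale act v h p \<and>
    scale a \<Lambda> =
      (\<Sum>i = 0..p - 1.
         cpoly_act scale (\<lambda>n w. scale (1 / c\<^sub>L\<^sub>I) (act (hv_elt (HI (- int n))) w)) (schur i)
           (act (hv_elt (HL (int i - int p))) v)) + x"
proof -
  let ?l = "\<lambda>n. act (hv_elt (HL n))" and ?i = "\<lambda>n. act (hv_elt (HI n))"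
  note verma = assms(4)[unfolded verma_module_def hv_module_def]
  have vs: "vector_space scale" using verma by blast
  interpret vector_space scale by (rule vs)
  have bracket: "act (hv_elt a) (act (hv_elt b) w)
      = act (hv_elt b) (act (hv_elt a) w) + act (hv_bracket_basis a b) w" for a b w
    using verma hv_bracket_elt[of a b] by (metis add_diff_cancel_left' diff_add_cancel add.commute)
  have lin: "Vector_Spaces.linear hv_scale scale (\<lambda>X. act X w)" for w
    using verma by blast
  interpret act: Vector_Spaces.linear hv_scale scale "\<lambda>X. act X w" for w
    by (rule lin)
  interpret hv_highest_weight scale ?l ?i c\<^sub>L\<^sub>I h h\<^sub>I v p
  proof (intro hv_highest_weight.intro hv_highest_weight_axioms.intro)
    show "vector_space scale" by (rule vs)
    show "Vector_Spaces.linear scale scale (?l n)" "Vector_Spaces.linear scale scale (?i n)" for n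
      using verma by blast+
    show "?l n (?l m w) = ?l m (?l n w) + scale (of_int (n - m)) (?l (n + m) w)"
      if "n + m \<noteq> 0" for n m w
      using that bracket[of "HL n" "HL m" w] by (auto simp: act.scale)
    show "?l n (?i m w) = ?i m (?l n w) - scale (of_int m) (?i (n + m) w)
      - (if n = - m then scale (((of_int n)\<^sup>2 + of_int n) * c\<^sub>L\<^sub>I) w else 0)" for n m w
      using bracket[of "HL n" "HI m" w] verma by (simp add: act.scale act.diff act.neg act.zero)
    show "?i n (?i m w) = ?i m (?i n w)" for n m w
      using bracket[of "HI n" "HI m" w] verma by (auto simp: act.scale act.neg act.zero)
    show "?l n v = 0" "?i n v = 0" if "n > 0" for n using verma that by auto
    show "?l 0 v = scale h v" "?i 0 v = scale h\<^sub>I v" using verma by auto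
    fix P :: "'v \<Rightarrow> bool" and w
    show "P w" if "P v" "\<And>x y. P x \<Longrightarrow> P y \<Longrightarrow> P (x + y)" "\<And>a x. P x \<Longrightarrow> P (scale a x)"
      "\<And>m x. m > 0 \<Longrightarrow> P x \<Longrightarrow> P (?l (- m) x)" "\<And>m x. m > 0 \<Longrightarrow> P x \<Longrightarrow> P (?i (- m) x)"
      by (rule free_rank_one_induct[of scale act hv_minus_basis v P])
        (use verma that in \<open>auto simp: hv_minus_basis_def\<close>)
    show "c\<^sub>L\<^sub>I \<noteq> 0" "p > 0" by fact+
    show "h\<^sub>I = c\<^sub>L\<^sub>I * (1 - of_nat p)"
      using assms(1,3) by (simp add: field_simps)
  qed
  have "\<exists>a y. a \<noteq> 0 \<and> F (int p) 1 y \<and> scale a \<Lambda> = s + y"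
    using assms(5,6) by (intro singular_vector_form)
      (auto simp: weight_component_def singular_vector_def)
  then obtain a y where y: "a \<noteq> 0" "F (int p) 1 y" "scale a \<Lambda> = s + y" by blast
  have "y \<in> I_component scale act v h p"
    using F_imp_cpoly_act[OF y(2)] F_l_0[OF y(2)]
    by (auto simp: I_component_def weight_component_def)
  with y show ?thesis unfolding s_def by blast
qed

end
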